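(* For $t\in[0,1]$, the functional $\mathsf{F}_t^{\mathrm{spec}}(\rho,\sigma)=\operatorname{Tr}\big(\rho\,(\rho^{-1}\sharp\sigma)^{2t}\big)$ on pairs of $n\times n$ density matrices is invariant under unitary conjugations and tensor stabilizations: for any density matrices $\rho,\sigma$ of size $n\times n$, any $n\times n$ unitary $U$ and any density matrix $\tau$ (of arbitrary size), $$\mathsf{F}_t^{\mathrm{spec}}(U\rho U^*,\,U\sigma U^* )=\mathsf{F}_t^{\mathrm{spec}}(\rho,\sigma),\qquad \mathsf{F}_t^{\mathrm{spec}}(\rho\otimes\tau,\,\sigma\otimes\tau)=\mathsf{F}_t^{\mathrm{spec}}(\rho,\sigma).$$
   Context: A density matrix (density operator, state) is a positive semidefinite complex square matrix of trace one. For positive definite $A,B$, the matrix geometric mean is $A\sharp B=A^{1/2}(A^{-1/2}BA^{-1/2})^{1/2}A^{1/2}$. Explicitly $\rho^{-1}\sharp\sigma=\rho^{-1/2}(\rho^{1/2}\sigma\rho^{1/2})^{1/2}\rho^{-1/2}$; for singular states this formula is used with inverse and fractional powers interpreted on the support of the corresponding operator (zero on its kernel), and $X^0=I$. *)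

theory Defs
  imports Complex_Main "Jordan_Normal_Form.Schur_Decomposition"
begin

definition mat_trace :: "complex mat \<Rightarrow> complex" where
  "mat_trace A = (\<Sum>i<dim_row A. A $$ (i, i))"

definition unitary_mat :: "nat \<Rightarrow> complex mat \<Rightarrow> bool" where
  "unitary_mat n U \<longleftrightarrow>
     U \<in> carrier_mat n n \<and> U * mat_adjoint U = 1\<^sub>m n \<and> mat_adjoint U * U = 1\<^sub>m n"

definition psd_mat :: "nat \<Rightarrow> complex mat \<Rightarrow> bool" where
  "psd_mat n A \<longleftrightarrow>
     A \<in> carrier_mat n n \<and> mat_adjoint A = A \<and>
     (\<forall>v \<in> carrier_vec n. 0 \<le> Re ((A *\<^sub>v v) \<bullet>c v))"

definition density_mat :: "nat \<Rightarrow> complex mat \<Rightarrow> bool" where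
  "density_mat n \<rho> \<longleftrightarrow> psd_mat n \<rho> \<and> mat_trace \<rho> = 1"

text \<open>Kronecker product, the index pair (i, k) being encoded as i * dim_row B + k.\<close>

definition kron :: "complex mat \<Rightarrow> complex mat \<Rightarrow> complex mat" where
  "kron A B = mat (dim_row A * dim_row B) (dim_col A * dim_col B)
     (\<lambda>(i, j). A $$ (i div dim_row B, j div dim_col B) * B $$ (i mod dim_row B, j mod dim_col B))"

abbreviation real_diag :: "nat \<Rightarrow> (nat \<Rightarrow> real) \<Rightarrow> complex mat" where
  "real_diag n d \<equiv> mat_diag n (\<lambda>i. complex_of_real (d i))"

text \<open>Functional calculus for Hermitian matrices: f is applied to the eigenvalues in a unitary
  diagonalization. The lemma \<open>herm_fun_eqI\<close> below shows that the result does not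
  depend on the diagonalization.\<close>

definition herm_fun :: "(real \<Rightarrow> real) \<Rightarrow> complex mat \<Rightarrow> complex mat" where
  "herm_fun f A = (THE B. \<exists>U d. unitary_mat (dim_row A) U \<and>
     A = U * real_diag (dim_row A) d * mat_adjoint U \<and>
     B = U * real_diag (dim_row A) (\<lambda>i. f (d i)) * mat_adjoint U)"

lemma mat_adjoint_carrier [simp, intro]:
  "A \<in> carrier_mat n m \<Longrightarrow> mat_adjoint A \<in> carrier_mat m n"
  unfolding mat_adjoint_def by (intro carrier_matI) auto

lemma unitary_diag_fun_unique:
  assumes U: "unitary_mat n U" and V: "unitary_mat n V"
    and eq: "U * real_diag n d * mat_adjoint U = V * real_diag n e * mat_adjoint V"
  shows "U * real_diag n (\<lambda>i. f (d i)) * mat_adjoint U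
       = V * real_diag n (\<lambda>i. f (e i)) * mat_adjoint V"
proof -
  let ?U = "mat_adjoint U" and ?V = "mat_adjoint V"
  have cU: "U \<in> carrier_mat n n" "?U \<in> carrier_mat n n"
    and cV: "V \<in> carrier_mat n n" "?V \<in> carrier_mat n n"
    and UU: "U * ?U = 1\<^sub>m n" "?U * U = 1\<^sub>m n" and VV: "V * ?V = 1\<^sub>m n" "?V * V = 1\<^sub>m n"
    using U V by (auto simp: unitary_mat_def)
  have mc [simp]: "A * B \<in> carrier_mat n n"
    if "A \<in> carrier_mat n n" "B \<in> carrier_mat n n" for A B :: "complex mat"
    using that by (rule mult_carrier_mat)
  have assoc: "A * B * C = A * (B * C)"
    if "A \<in> carrier_mat n n" "B \<in> carrier_mat n n" "C \<in> carrier_mat n n" for A B C :: "complex mat"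
    using that by (rule assoc_mult_mat)
  define W where "W = ?V * U"
  have cW: "W \<in> carrier_mat n n" using cU cV by (simp add: W_def)
  have to_W: "?V * (U * D * ?U) * U = W * D" if "D \<in> carrier_mat n n" for D
  proof -
    have "?V * (U * D * ?U) * U = ?V * U * D * (?U * U)"
      using that cU cV by (simp add: assoc)
    then show ?thesis using that cW by (simp add: UU W_def[symmetric])
  qed
  have to_W': "?V * (V * D * ?V) * U = D * W" if "D \<in> carrier_mat n n" for D
  proof -
    have "?V * (V * D * ?V) * U = ?V * V * D * (?V * U)"
      using that cU cV by (simp add: assoc)
    then show ?thesis using that cW by (simp add: VV W_def[symmetric])
  qed
  have "W * real_diag n d = real_diag n e * W"
    using to_W[of "real_diag n d"] to_W'[of "real_diag n e"] eq by simp
  then have entry: "W $$ (i, j) * complex_of_real (d j) = complex_of_real (e i) * W $$ (i, j)"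
    if "i < n" "j < n" for i j
    unfolding mat_diag_mult_left[OF cW] mat_diag_mult_right[OF cW]
    using that by (auto dest!: arg_cong[where f = "\<lambda>M. M $$ (i, j)"])
  have "W $$ (i, j) * complex_of_real (f (d j)) = complex_of_real (f (e i)) * W $$ (i, j)"
    if "i < n" "j < n" for i j
    using entry[OF that] by (cases "W $$ (i, j) = 0") auto
  then have Wf: "W * real_diag n (\<lambda>i. f (d i)) = real_diag n (\<lambda>i. f (e i)) * W"
    unfolding mat_diag_mult_left[OF cW] mat_diag_mult_right[OF cW] by (intro eq_matI) auto
  have VW: "V * W = U"
    using cU cV by (simp add: W_def VV flip: assoc)
  have WU: "W * ?U = ?V"
    using cU cV by (simp add: W_def UU assoc right_mult_one_mat[OF cV(2)])
  have "U * real_diag n (\<lambda>i. f (d i)) * ?U = V * (W * real_diag n (\<lambda>i. f (d i))) * ?U"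
    using cV cW by (simp add: VW flip: assoc)
  also have "\<dots> = V * real_diag n (\<lambda>i. f (e i)) * (W * ?U)"
    using cU cV cW by (simp add: Wf assoc)
  finally show ?thesis by (simp add: WU)
qed

lemma herm_fun_eqI:
  assumes U: "unitary_mat n U" and A: "A = U * real_diag n d * mat_adjoint U"
  shows "herm_fun f A = U * real_diag n (\<lambda>i. f (d i)) * mat_adjoint U"
proof -
  have "dim_row A = n" using U A by (auto simp: unitary_mat_def)
  then show ?thesis
    unfolding herm_fun_def
  proof (intro the_equality, goal_cases)
    case 1
    then show ?case using U A by blast
  next
    case (2 B)
    then obtain V e where V: "unitary_mat n V" "A = V * real_diag n e * mat_adjoint V"
      "B = V * real_diag n (\<lambda>i. f (e i)) * mat_adjoint V" by auto
    then show ?case using unitary_diag_fun_unique[OF V(1) U] A by metis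
  qed
qed

text \<open>Real powers of a positive semidefinite matrix, taken on the support: the function
  \<open>\<lambda>x. x powr s\<close> maps 0 to 0 for every s (negative s included), so the
  kernel is sent to zero. The exponent 0 is the exception and gives the identity matrix.\<close>

definition mat_rpow :: "complex mat \<Rightarrow> real \<Rightarrow> complex mat" where
  "mat_rpow A s = (if s = 0 then 1\<^sub>m (dim_row A) else herm_fun (\<lambda>x. x powr s) A)"

text \<open>The geometric mean of the inverse of \<open>\<rho>\<close> with \<open>\<sigma>\<close>; for singular
  \<open>\<rho>\<close> this formula is the definition.\<close>

definition inv_geom_mean :: "complex mat \<Rightarrow> complex mat \<Rightarrow> complex mat" where
  "inv_geom_mean \<rho> \<sigma> =
     mat_rpow \<rho> (- 1/2) * mat_rpow (mat_rpow \<rho> (1/2) * \<sigma> * mat_rpow \<rho> (1/2)) (1/2) * mat_rpow \<rho> (- 1/2)"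

definition F_spec :: "real \<Rightarrow> complex mat \<Rightarrow> complex mat \<Rightarrow> complex" where
  "F_spec t \<rho> \<sigma> = mat_trace (\<rho> * mat_rpow (inv_geom_mean \<rho> \<sigma>) (2 * t))"

end

theory Submission
  imports Defs "Jordan_Normal_Form.Spectral_Radius"
begin

text \<open>Everything that enters \<open>F_spec\<close> is built from products and real powers of positive
  semidefinite matrices, so both invariances reduce to how powers behave. By the spectral theorem
  (\<open>psd_diagonalization\<close>) a positive semidefinite \<open>A\<close> is \<open>U D U\<^sup>*\<close> with a nonnegative diagonal
  \<open>D\<close>, and every power of \<open>A\<close> is obtained by applying a scalar function to \<open>D\<close>
  (\<open>mat_rpow_diag\<close>).

  Unitary invariance follows because \<open>V U\<close> diagonalizes \<open>V A V\<^sup>*\<close>: powers, products and hence the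
  geometric mean commute with conjugation by \<open>V\<close>, and the trace does not see it.

  For tensor stabilization the statement proved is stronger: \<open>F_spec\<close> is multiplicative,
  \<open>F(\<rho> \<otimes> \<rho>', \<sigma> \<otimes> \<sigma>') = F(\<rho>, \<sigma>) F(\<rho>', \<sigma>')\<close> (\<open>F_spec_kron\<close>). The point is
  \<open>(A \<otimes> B)\<^sup>s = A\<^sup>s \<otimes> B\<^sup>s\<close> (\<open>mat_rpow_kron\<close>): \<open>U \<otimes> V\<close> diagonalizes \<open>A \<otimes> B\<close>, its
  eigenvalues are the products of eigenvalues of \<open>A\<close> and \<open>B\<close>, and real powers are multiplicative
  on the nonnegative reals. Together with the mixed product rule this makes the geometric mean
  and then the trace factor. Taking \<open>\<rho>' = \<sigma>' = \<tau>\<close>, the second factor is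
  \<open>tr \<tau>\<close> (\<open>F_spec_self\<close>): the geometric mean of \<open>\<tau>\<^sup>-\<^sup>1\<close> with \<open>\<tau>\<close> is the projection onto the
  support of \<open>\<tau>\<close>, and any power of it is absorbed by \<open>\<tau>\<close>. For a density matrix
  that factor is 1. Singular states fit in because powers taken on supports obey the same
  multiplication rule.\<close>

section \<open>Adjoints and unitary conjugation\<close>

lemma adjoint_index [simp]:
  assumes "i < dim_col A" "j < dim_row A"
  shows "mat_adjoint A $$ (i, j) = cnj (A $$ (j, i))"
  using assms by (simp add: mat_adjoint_def mat_of_rows_index)

lemma adjoint_dim [simp]:
  "dim_row (mat_adjoint A) = dim_col A" "dim_col (mat_adjoint A) = dim_row A"
  by (simp_all add: mat_adjoint_def)

lemma adjoint_adjoint [simp]: "mat_adjoint (mat_adjoint A) = (A :: complex mat)"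
  by (rule eq_matI) auto

lemma adjoint_mult:
  fixes A B :: "complex mat"
  assumes "A \<in> carrier_mat n k" "B \<in> carrier_mat k m"
  shows "mat_adjoint (A * B) = mat_adjoint B * mat_adjoint A"
  using assms by (intro eq_matI) (auto simp: scalar_prod_def mult.commute)

lemma adjoint_real_diag [simp]: "mat_adjoint (real_diag n d) = real_diag n d"
  by (rule eq_matI) (auto simp: mat_diag_def)

lemma adjoint_one [simp]: "mat_adjoint (1\<^sub>m n) = (1\<^sub>m n :: complex mat)"
  by (rule eq_matI) auto

lemma mat_diag_cong:
  assumes "\<And>i. i < n \<Longrightarrow> f i = g i"
  shows "mat_diag n f = mat_diag n g"
  using assms by (intro eq_matI) (auto simp: mat_diag_def)

lemma square_assoc:
  fixes A B C :: "complex mat"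
  assumes "A \<in> carrier_mat n n" "B \<in> carrier_mat n n" "C \<in> carrier_mat n n"
  shows "A * B * C = A * (B * C)"
  using assms by (rule assoc_mult_mat)

lemma square_mult_carrier [simp, intro]:
  fixes A B :: "complex mat"
  assumes "A \<in> carrier_mat n n" "B \<in> carrier_mat n n"
  shows "A * B \<in> carrier_mat n n"
  using assms by (rule mult_carrier_mat)

lemma unitary_mat_carrier: "unitary_mat n U \<Longrightarrow> U \<in> carrier_mat n n"
  by (simp add: unitary_mat_def)

lemma unitary_mat_adjoint: "unitary_mat n U \<Longrightarrow> unitary_mat n (mat_adjoint U)"
  by (auto simp: unitary_mat_def)

lemma unitary_matI:
  assumes "U \<in> carrier_mat n n" "mat_adjoint U * U = 1\<^sub>m n"
  shows "unitary_mat n U"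
  using assms mat_mult_left_right_inverse[of "mat_adjoint U" n U] by (auto simp: unitary_mat_def)

lemma adjoint_mult_vec_scalar_prod:
  fixes A :: "complex mat"
  assumes A: "A \<in> carrier_mat n m" and w: "w \<in> carrier_vec n" and v: "v \<in> carrier_vec m"
  shows "(mat_adjoint A *\<^sub>v w) \<bullet>c v = w \<bullet>c (A *\<^sub>v v)"
proof -
  have "(mat_adjoint A *\<^sub>v w) \<bullet>c v = (\<Sum>j<m. \<Sum>i<n. cnj (A $$ (i, j)) * w $ i * cnj (v $ j))"
    using assms by (auto simp: scalar_prod_def atLeast0LessThan sum_distrib_right)
  also have "\<dots> = (\<Sum>i<n. \<Sum>j<m. cnj (A $$ (i, j)) * w $ i * cnj (v $ j))"
    by (rule sum.swap)
  also have "\<dots> = w \<bullet>c (A *\<^sub>v v)"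
    using assms by (auto simp: scalar_prod_def atLeast0LessThan sum_distrib_left mult_ac)
  finally show ?thesis .
qed

lemma unitary_mult:
  assumes U: "unitary_mat n U" and V: "unitary_mat n V"
  shows "unitary_mat n (U * V)"
proof (rule unitary_matI)
  have c: "U \<in> carrier_mat n n" "V \<in> carrier_mat n n"
    using U V by (auto simp: unitary_mat_def)
  then show "U * V \<in> carrier_mat n n" by simp
  have "mat_adjoint (U * V) * (U * V) = mat_adjoint V * (mat_adjoint U * U * V)"
    using c by (simp add: adjoint_mult square_assoc[of _ n])
  then show "mat_adjoint (U * V) * (U * V) = 1\<^sub>m n"
    using U V c by (simp add: unitary_mat_def)
qed

lemma mat_conj_conj:
  fixes X Y A :: "complex mat"
  assumes "X \<in> carrier_mat n n" "Y \<in> carrier_mat n n" "A \<in> carrier_mat n n"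
  shows "X * (Y * A * mat_adjoint Y) * mat_adjoint X = (X * Y) * A * mat_adjoint (X * Y)"
  using assms by (simp add: adjoint_mult[OF assms(1,2)] square_assoc[of _ n])

lemma unitary_conj_cancel:
  assumes U: "unitary_mat n U" and A: "A \<in> carrier_mat n n"
  shows "U * (mat_adjoint U * A * U) * mat_adjoint U = A"
proof -
  have c: "U \<in> carrier_mat n n" using U by (simp add: unitary_mat_def)
  have "U * (mat_adjoint U * A * mat_adjoint (mat_adjoint U)) * mat_adjoint U
      = (U * mat_adjoint U) * A * mat_adjoint (U * mat_adjoint U)"
    using c A by (intro mat_conj_conj) auto
  then show ?thesis using U A by (simp add: unitary_mat_def)
qed

lemma unitary_conj_mult:
  assumes U: "unitary_mat n U" and A: "A \<in> carrier_mat n n" and B: "B \<in> carrier_mat n n"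
  shows "(U * A * mat_adjoint U) * (U * B * mat_adjoint U) = U * (A * B) * mat_adjoint U"
proof -
  have c: "U \<in> carrier_mat n n" using U by (simp add: unitary_mat_def)
  have "(U * A * mat_adjoint U) * (U * B * mat_adjoint U)
      = U * A * ((mat_adjoint U * U) * (B * mat_adjoint U))"
    using c A B by (simp add: square_assoc[of _ n])
  also have "\<dots> = U * A * (B * mat_adjoint U)"
    using U c A B by (simp add: unitary_mat_def left_mult_one_mat[of _ n n])
  finally show ?thesis using c A B by (simp add: square_assoc[of _ n])
qed

section \<open>The spectral theorem for Hermitian matrices\<close>

text \<open>Complete \<open>v\<close> to a basis, orthogonalize, and normalize. The scalar \<open>c\<close> is the normalization
  of \<open>v\<close>; an eigenvector stays one under this rescaling.\<close>

lemma unitary_with_first_column: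
  fixes v :: "complex vec"
  assumes v: "v \<in> carrier_vec n" and v0: "v \<noteq> 0\<^sub>v n"
  obtains W c where "unitary_mat n W" "col W 0 = c \<cdot>\<^sub>v v"
proof -
  interpret cof_vec_space n "TYPE(complex)" .
  define b where "b = basis_completion v"
  from basis_completion[OF v v0, folded b_def]
  have dist: "distinct b" and indep: "\<not> lin_dep (set b)" and b: "set b \<subseteq> carrier_vec n"
    and hdb: "hd b = v" and len: "length b = n" by auto
  have n: "0 < n" using v v0 by (cases n) auto
  obtain vs where bv: "b = v # vs" using hdb len n by (cases b) auto
  define ws where "ws = gram_schmidt n b"
  from gram_schmidt_result[OF b dist indep refl, folded ws_def]
  have ws: "set ws \<subseteq> carrier_vec n" "corthogonal ws" and lws: "length ws = n"
    by (auto simp: len)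
  have hdws: "ws ! 0 = v"
    using gram_schmidt_hd[OF v, of vs, folded bv] lws n by (cases ws) (auto simp: ws_def[symmetric])
  define r where "r i = complex_of_real (1 / sqrt (Re (ws ! i \<bullet>c ws ! i)))" for i
  define W where "W = mat n n (\<lambda>(i, j). r j * ws ! j $ i)"
  have cw: "ws ! i \<in> carrier_vec n" if "i < n" for i
    using ws lws that by auto
  have WW: "(mat_adjoint W * W) $$ (i, j) = (if i = j then 1 else 0)" if ij: "i < n" "j < n" for i j
  proof -
    have "(mat_adjoint W * W) $$ (i, j) = cnj (r i) * r j * (ws ! j \<bullet>c ws ! i)"
      using ij cw[OF ij(1)] cw[OF ij(2)]
      by (auto simp: W_def scalar_prod_def sum_distrib_left mult_ac intro!: sum.cong)
    also have "\<dots> = (if i = j then 1 else 0)"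
    proof (cases "i = j")
      case True
      have "ws ! i \<bullet>c ws ! i \<noteq> 0" using ws(2) ij(1) lws by (simp add: corthogonalD)
      moreover have nn: "0 \<le> ws ! i \<bullet>c ws ! i" by (rule conjugate_square_ge_0_vec)
      ultimately have pos: "0 < Re (ws ! i \<bullet>c ws ! i)" and im: "Im (ws ! i \<bullet>c ws ! i) = 0"
        by (auto simp: less_eq_complex_def complex_eq_iff)
      have "ws ! i \<bullet>c ws ! i = complex_of_real (Re (ws ! i \<bullet>c ws ! i))"
        using im by (simp add: complex_eq_iff)
      moreover have "cnj (r i) * r i = complex_of_real (1 / Re (ws ! i \<bullet>c ws ! i))"
        using pos by (simp add: r_def flip: of_real_mult of_real_divide)
      ultimately have "cnj (r i) * r i * (ws ! i \<bullet>c ws ! i)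
          = complex_of_real (1 / Re (ws ! i \<bullet>c ws ! i) * Re (ws ! i \<bullet>c ws ! i))"
        by (metis of_real_mult)
      then show ?thesis using True pos by simp
    next
      case False
      then have "ws ! j \<bullet>c ws ! i = 0" using ws(2) ij lws by (simp add: corthogonalD)
      then show ?thesis using False by simp
    qed
    finally show ?thesis .
  qed
  have "unitary_mat n W"
  proof (rule unitary_matI)
    show "W \<in> carrier_mat n n" by (simp add: W_def)
    show "mat_adjoint W * W = 1\<^sub>m n"
      using WW by (intro eq_matI) (auto simp: W_def)
  qed
  moreover have "col W 0 = r 0 \<cdot>\<^sub>v v"
    using n v hdws by (intro eq_vecI) (auto simp: W_def)
  ultimately show ?thesis by (rule that)
qed

lemma adjoint_four_block_diag:
  fixes A D :: "complex mat"
  assumes "A \<in> carrier_mat n n" "D \<in> carrier_mat m m"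
  shows "mat_adjoint (four_block_mat A (0\<^sub>m n m) (0\<^sub>m m n) D)
       = four_block_mat (mat_adjoint A) (0\<^sub>m n m) (0\<^sub>m m n) (mat_adjoint D)"
  using assms by (intro eq_matI) auto

lemma mult_four_block_diag:
  fixes A B C D :: "complex mat"
  assumes "A \<in> carrier_mat n n" "B \<in> carrier_mat n n" "C \<in> carrier_mat m m" "D \<in> carrier_mat m m"
  shows "four_block_mat A (0\<^sub>m n m) (0\<^sub>m m n) C * four_block_mat B (0\<^sub>m n m) (0\<^sub>m m n) D
       = four_block_mat (A * B) (0\<^sub>m n m) (0\<^sub>m m n) (C * D)"
  using assms by (subst mult_four_block_mat[of _ n n _ m _ m _ _ n _ m]) auto

text \<open>Deflation: in an orthonormal basis starting with an eigenvector, the first column of the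
  matrix is \<open>(e, 0, \<dots>, 0)\<close>; hermiticity then clears the first row and makes \<open>e\<close> real, and the
  remaining block is Hermitian of smaller size.\<close>

theorem hermitian_diagonalization:
  assumes "A \<in> carrier_mat n n" "mat_adjoint A = A"
  shows "\<exists>U d. unitary_mat n U \<and> A = U * real_diag n d * mat_adjoint U"
  using assms
proof (induction n arbitrary: A)
  case 0
  then show ?case
    by (intro exI[of _ "1\<^sub>m 0"] exI[of _ "\<lambda>_. 0"] conjI eq_matI) (auto simp: unitary_mat_def)
next
  case (Suc k A)
  let ?n = "Suc k"
  have A: "A \<in> carrier_mat ?n ?n" and hA: "mat_adjoint A = A" using Suc.prems by auto
  obtain e where "eigenvalue A e"
    using spectrum_non_empty[OF A] by (auto simp: spectrum_def)
  then obtain v where v: "v \<in> carrier_vec ?n" "v \<noteq> 0\<^sub>v ?n" and ev: "A *\<^sub>v v = e \<cdot>\<^sub>v v"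
    using A by (auto simp: eigenvalue_def eigenvector_def)
  obtain W c where W: "unitary_mat ?n W" and W0: "col W 0 = c \<cdot>\<^sub>v v"
    using unitary_with_first_column[OF v] .
  have cW: "W \<in> carrier_mat ?n ?n" and WW: "mat_adjoint W * W = 1\<^sub>m ?n"
    using W by (auto simp: unitary_mat_def)
  define B where "B = mat_adjoint W * A * W"
  have B: "B \<in> carrier_mat ?n ?n" using A cW by (auto simp: B_def)
  have hB: "mat_adjoint B = B"
    using A cW hA
    by (simp add: B_def adjoint_mult[of _ ?n ?n _ ?n] square_assoc[of _ ?n])
  have "col (A * W) 0 = A *\<^sub>v (c \<cdot>\<^sub>v v)"
    using col_mult2[OF A cW, of 0] W0 by simp
  also have "\<dots> = c \<cdot>\<^sub>v (e \<cdot>\<^sub>v v)" using mult_mat_vec[OF A v(1)] ev by simp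
  also have "\<dots> = e \<cdot>\<^sub>v col W 0" by (simp add: W0 smult_smult_assoc mult.commute)
  finally have AW: "col (A * W) 0 = e \<cdot>\<^sub>v col W 0" .
  have col0: "B $$ (i, 0) = (if i = 0 then e else 0)" if i: "i < ?n" for i
  proof -
    have "B = mat_adjoint W * (A * W)"
      using A cW by (simp add: B_def square_assoc[of _ ?n])
    then have "B $$ (i, 0) = row (mat_adjoint W) i \<bullet> (e \<cdot>\<^sub>v col W 0)"
      using A cW i AW by simp
    also have "\<dots> = e * (mat_adjoint W * W) $$ (i, 0)"
      using cW i by simp
    finally show ?thesis using i by (simp add: WW)
  qed
  have herm: "B $$ (i, j) = cnj (B $$ (j, i))" if "i < ?n" "j < ?n" for i j
    using adjoint_index[of i B j] B that by (simp add: hB)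
  have row0: "B $$ (0, j) = (if j = 0 then e else 0)" if "j < ?n" for j
    using herm[OF zero_less_Suc that] col0[OF that] by (cases "j = 0") auto
  have e: "complex_of_real (Re e) = e"
    using herm[of 0 0] col0[of 0] by (simp add: complex_eq_iff)
  define B' where "B' = mat k k (\<lambda>(i, j). B $$ (Suc i, Suc j))"
  have B': "B' \<in> carrier_mat k k" by (simp add: B'_def)
  have "mat_adjoint B' = B'"
    by (intro eq_matI) (auto simp: B'_def intro: herm[symmetric])
  then obtain V d where V: "unitary_mat k V" and Vd: "B' = V * real_diag k d * mat_adjoint V"
    using Suc.IH[OF B'] by blast
  have cV: "V \<in> carrier_mat k k" using V by (simp add: unitary_mat_def)
  let ?bd = "\<lambda>X Y. four_block_mat X (0\<^sub>m 1 k) (0\<^sub>m k 1) Y :: complex mat"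
  define X where "X = ?bd (1\<^sub>m 1) V"
  define f where "f = (\<lambda>i. case i of 0 \<Rightarrow> Re e | Suc i \<Rightarrow> d i)"
  have cX: "X \<in> carrier_mat ?n ?n"
    using four_block_carrier_mat[of "1\<^sub>m 1 :: complex mat" 1 1 V k k] cV by (simp add: X_def)
  have aX: "mat_adjoint X = ?bd (1\<^sub>m 1) (mat_adjoint V)"
    using cV by (simp add: X_def adjoint_four_block_diag)
  have uX: "unitary_mat ?n X"
  proof (rule unitary_matI[OF cX])
    show "mat_adjoint X * X = 1\<^sub>m ?n"
      unfolding aX unfolding X_def using V cV by (simp add: mult_four_block_diag unitary_mat_def)
  qed
  have D: "real_diag ?n f = ?bd (real_diag 1 (\<lambda>_. Re e)) (real_diag k d)"
    by (rule eq_matI) (auto simp: mat_diag_def f_def split: nat.split)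
  have "X * real_diag ?n f * mat_adjoint X = ?bd (real_diag 1 (\<lambda>_. Re e)) B'"
    unfolding aX D unfolding X_def Vd using cV
    by (simp add: mult_four_block_diag left_mult_one_mat[of _ "Suc 0" "Suc 0"]
        right_mult_one_mat[of _ "Suc 0" "Suc 0"])
  also have "\<dots> = B"
  proof (rule eq_matI)
    fix i j assume "i < dim_row B" "j < dim_col B"
    then have ij: "i < ?n" "j < ?n" using B by auto
    show "?bd (real_diag 1 (\<lambda>_. Re e)) B' $$ (i, j) = B $$ (i, j)"
      using ij col0[OF ij(1)] row0[OF ij(2)] e
      by (cases i; cases j) (auto simp: mat_diag_def B'_def)
  qed (use B B' in \<open>auto simp: mat_diag_def\<close>)
  finally have "A = W * (X * real_diag ?n f * mat_adjoint X) * mat_adjoint W"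
    using unitary_conj_cancel[OF W A] by (simp add: B_def)
  then have "A = (W * X) * real_diag ?n f * mat_adjoint (W * X)"
    using mat_conj_conj[OF cW cX mat_diag_dim] by metis
  then show ?case using unitary_mult[OF W uX] by blast
qed

section \<open>Positive semidefinite matrices and their powers\<close>

lemma psd_mat_carrier: "psd_mat n A \<Longrightarrow> A \<in> carrier_mat n n"
  by (simp add: psd_mat_def)

lemma psd_mat_conj:
  assumes B: "psd_mat n B" and X: "X \<in> carrier_mat n n"
  shows "psd_mat n (X * B * mat_adjoint X)"
  unfolding psd_mat_def
proof (intro conjI ballI)
  have cB: "B \<in> carrier_mat n n" and hB: "mat_adjoint B = B" using B by (auto simp: psd_mat_def)
  show "X * B * mat_adjoint X \<in> carrier_mat n n" using cB X by auto
  show "mat_adjoint (X * B * mat_adjoint X) = X * B * mat_adjoint X"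
    using cB X hB by (simp add: adjoint_mult[of _ n n _ n] square_assoc[of _ n])
  fix v :: "complex vec" assume v: "v \<in> carrier_vec n"
  define w where "w = mat_adjoint X *\<^sub>v v"
  have w: "w \<in> carrier_vec n" using X v by (simp add: w_def mult_mat_vec_carrier[of _ n n])
  have "(X * B * mat_adjoint X) *\<^sub>v v = X *\<^sub>v (B *\<^sub>v w)"
    using X cB v by (simp add: w_def assoc_mult_mat_vec[of _ n n _ n] square_assoc[of _ n])
  also have "(X *\<^sub>v (B *\<^sub>v w)) \<bullet>c v = (B *\<^sub>v w) \<bullet>c w"
    using adjoint_mult_vec_scalar_prod[of "mat_adjoint X" n n "B *\<^sub>v w" v] X cB w v
    by (simp add: w_def mult_mat_vec_carrier[of _ n n])
  finally show "0 \<le> Re (((X * B * mat_adjoint X) *\<^sub>v v) \<bullet>c v)"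
    using B w by (simp add: psd_mat_def)
qed

lemma real_diag_quadratic_form:
  assumes v: "v \<in> carrier_vec n"
  shows "Re ((real_diag n d *\<^sub>v v) \<bullet>c v) = (\<Sum>i<n. d i * (cmod (v $ i))\<^sup>2)"
proof -
  have "(real_diag n d *\<^sub>v v) $ i = d i * v $ i" if "i < n" for i
  proof -
    have "(real_diag n d *\<^sub>v v) $ i = (\<Sum>j<n. (if i = j then complex_of_real (d j) else 0) * v $ j)"
      using that v by (auto simp: mat_diag_def scalar_prod_def atLeast0LessThan)
    also have "\<dots> = (\<Sum>j<n. if i = j then d j * v $ j else 0)"
      by (intro sum.cong) auto
    finally show ?thesis using that by simp
  qed
  then have "(real_diag n d *\<^sub>v v) \<bullet>c v = (\<Sum>i<n. d i * (v $ i * cnj (v $ i)))"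
    using v by (simp add: scalar_prod_def atLeast0LessThan mult.assoc)
  also have "\<dots> = complex_of_real (\<Sum>i<n. d i * (cmod (v $ i))\<^sup>2)"
    by (simp only: of_real_sum of_real_mult complex_norm_square)
  finally show ?thesis by simp
qed

lemma psd_real_diag_iff: "psd_mat n (real_diag n d) \<longleftrightarrow> (\<forall>i<n. 0 \<le> d i)"
proof (intro iffI allI impI)
  fix i assume *: "psd_mat n (real_diag n d)" and i: "i < n"
  have "0 \<le> (\<Sum>j<n. d j * (cmod (unit_vec n i $ j))\<^sup>2)"
    using * unfolding psd_mat_def
    by (metis real_diag_quadratic_form[of "unit_vec n i" n d] unit_vec_carrier)
  also have "\<dots> = (\<Sum>j<n. if j = i then d i else 0)"
    using i by (intro sum.cong) auto
  finally show "0 \<le> d i" using i by simp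
next
  assume "\<forall>i<n. 0 \<le> d i"
  then show "psd_mat n (real_diag n d)"
    by (auto simp: psd_mat_def real_diag_quadratic_form intro!: sum_nonneg)
qed

text \<open>The eigenvalues are nonnegative because the diagonal matrix \<open>U\<^sup>* A U\<close> is again positive
  semidefinite.\<close>

lemma psd_diagonalization:
  assumes A: "psd_mat n A"
  obtains U d where "unitary_mat n U" "\<And>i. i < n \<Longrightarrow> 0 \<le> d i"
    "A = U * real_diag n d * mat_adjoint U"
proof -
  obtain U d where U: "unitary_mat n U" and d: "A = U * real_diag n d * mat_adjoint U"
    using hermitian_diagonalization[of A n] A by (auto simp: psd_mat_def)
  have "mat_adjoint U * A * mat_adjoint (mat_adjoint U) = real_diag n d"
    using unitary_conj_cancel[OF unitary_mat_adjoint[OF U], of "real_diag n d"] d by simp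
  then have "psd_mat n (real_diag n d)"
    using psd_mat_conj[OF A, of "mat_adjoint U"] U by (simp add: unitary_mat_carrier)
  then show ?thesis using U d by (intro that) (auto simp: psd_real_diag_iff)
qed

text \<open>The scalar function underlying \<open>mat_rpow\<close>: since \<open>0 powr s = 0\<close> for every \<open>s\<close>, the exponent 0
  needs the separate value 1 to match the convention that the zeroth power is the identity.\<close>

definition supp_powr :: "real \<Rightarrow> real \<Rightarrow> real" where
  "supp_powr s x = (if s = 0 then 1 else x powr s)"

lemma supp_powr_nonneg: "0 \<le> supp_powr s x"
  by (simp add: supp_powr_def)

lemma supp_powr_mult: "0 \<le> x \<Longrightarrow> 0 \<le> y \<Longrightarrow> supp_powr s (x * y) = supp_powr s x * supp_powr s y"
  by (simp add: supp_powr_def powr_mult)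

text \<open>For exponent 0 this is \<open>U U\<^sup>* = 1\<close>, so the two cases in the definition of \<open>mat_rpow\<close> need not be
  separated any more.\<close>

lemma mat_rpow_diag:
  assumes U: "unitary_mat n U" and A: "A = U * real_diag n d * mat_adjoint U"
  shows "mat_rpow A s = U * real_diag n (\<lambda>i. supp_powr s (d i)) * mat_adjoint U"
proof (cases "s = 0")
  case True
  have "dim_row A = n" using U by (auto simp: A unitary_mat_def)
  then show ?thesis
    using True U
    by (simp add: mat_rpow_def supp_powr_def unitary_mat_def right_mult_one_mat[of U n n])
next
  case False
  then show ?thesis by (simp add: mat_rpow_def supp_powr_def herm_fun_eqI[OF U A])
qed

lemma psd_mat_rpow:
  assumes A: "psd_mat n A"
  shows "psd_mat n (mat_rpow A s)"
proof -
  obtain U d where U: "unitary_mat n U" and d: "A = U * real_diag n d * mat_adjoint U"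
    using psd_diagonalization[OF A] .
  show ?thesis
    unfolding mat_rpow_diag[OF U d] using U
    by (intro psd_mat_conj) (auto simp: psd_real_diag_iff supp_powr_nonneg unitary_mat_carrier)
qed

lemma mat_rpow_unitary_conj:
  assumes A: "psd_mat n A" and V: "unitary_mat n V"
  shows "mat_rpow (V * A * mat_adjoint V) s = V * mat_rpow A s * mat_adjoint V"
proof -
  obtain U d where U: "unitary_mat n U" and d: "A = U * real_diag n d * mat_adjoint U"
    using psd_diagonalization[OF A] .
  note conj = mat_conj_conj[OF unitary_mat_carrier[OF V] unitary_mat_carrier[OF U] mat_diag_dim]
  show ?thesis
    using mat_rpow_diag[OF unitary_mult[OF V U], of "V * A * mat_adjoint V" d s]
    by (simp add: conj d mat_rpow_diag[OF U refl])
qed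

text \<open>The geometric mean applies this pattern twice: with exponent \<open>1/2\<close> for the matrix under the
  root, and with exponent \<open>-1/2\<close> and the root in place of \<open>\<sigma>\<close>.\<close>

lemma psd_inner_geom_mean:
  assumes "psd_mat n \<rho>" "psd_mat n \<sigma>"
  shows "psd_mat n (mat_rpow \<rho> s * \<sigma> * mat_rpow \<rho> s)"
proof -
  have P: "psd_mat n (mat_rpow \<rho> s)" by (rule psd_mat_rpow) fact
  then have "mat_adjoint (mat_rpow \<rho> s) = mat_rpow \<rho> s" by (simp add: psd_mat_def)
  then show ?thesis using psd_mat_conj[OF assms(2) psd_mat_carrier[OF P]] by simp
qed

lemma psd_inv_geom_mean:
  assumes "psd_mat n \<rho>" "psd_mat n \<sigma>"
  shows "psd_mat n (inv_geom_mean \<rho> \<sigma>)"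
  unfolding inv_geom_mean_def using assms
  by (intro psd_inner_geom_mean psd_mat_rpow)

section \<open>Unitary invariance\<close>

lemma mat_trace_comm:
  assumes "A \<in> carrier_mat n m" "B \<in> carrier_mat m n"
  shows "mat_trace (A * B) = mat_trace (B * A)"
proof -
  have "mat_trace (A * B) = (\<Sum>i<n. \<Sum>j<m. A $$ (i, j) * B $$ (j, i))"
    using assms by (auto simp: mat_trace_def scalar_prod_def atLeast0LessThan)
  also have "\<dots> = (\<Sum>j<m. \<Sum>i<n. A $$ (i, j) * B $$ (j, i))"
    by (rule sum.swap)
  also have "\<dots> = mat_trace (B * A)"
    using assms by (auto simp: mat_trace_def scalar_prod_def atLeast0LessThan mult.commute)
  finally show ?thesis .
qed

lemma mat_trace_unitary_conj:
  assumes U: "unitary_mat n U" and A: "A \<in> carrier_mat n n"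
  shows "mat_trace (U * A * mat_adjoint U) = mat_trace A"
proof -
  have c: "U \<in> carrier_mat n n" using U by (rule unitary_mat_carrier)
  have "mat_trace (U * A * mat_adjoint U) = mat_trace (mat_adjoint U * (U * A))"
    using c A by (intro mat_trace_comm[of _ n n]) auto
  also have "mat_adjoint U * (U * A) = mat_adjoint U * U * A"
    using c A by (simp add: square_assoc[of _ n])
  finally show ?thesis using U A by (simp add: unitary_mat_def)
qed

lemma inv_geom_mean_unitary_conj:
  assumes R: "psd_mat n \<rho>" and S: "psd_mat n \<sigma>" and U: "unitary_mat n U"
  shows "inv_geom_mean (U * \<rho> * mat_adjoint U) (U * \<sigma> * mat_adjoint U)
       = U * inv_geom_mean \<rho> \<sigma> * mat_adjoint U"
proof -
  have c: "mat_rpow \<rho> s \<in> carrier_mat n n" for s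
    by (intro psd_mat_carrier psd_mat_rpow R)
  have cS: "\<sigma> \<in> carrier_mat n n" using S by (rule psd_mat_carrier)
  have I: "psd_mat n (mat_rpow \<rho> s * \<sigma> * mat_rpow \<rho> s)" for s
    by (rule psd_inner_geom_mean[OF R S])
  have cI: "mat_rpow (mat_rpow \<rho> s * \<sigma> * mat_rpow \<rho> s) r \<in> carrier_mat n n" for s r
    by (intro psd_mat_carrier psd_mat_rpow I)
  show ?thesis
    unfolding inv_geom_mean_def mat_rpow_unitary_conj[OF R U]
    by (simp add: unitary_conj_mult[OF U] c cS cI mat_rpow_unitary_conj[OF I U])
qed

theorem F_spec_unitary_conj:
  assumes R: "psd_mat n \<rho>" and S: "psd_mat n \<sigma>" and U: "unitary_mat n U"
  shows "F_spec t (U * \<rho> * mat_adjoint U) (U * \<sigma> * mat_adjoint U) = F_spec t \<rho> \<sigma>"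
proof -
  have M: "psd_mat n (inv_geom_mean \<rho> \<sigma>)" by (rule psd_inv_geom_mean[OF R S])
  have c: "\<rho> \<in> carrier_mat n n" "mat_rpow (inv_geom_mean \<rho> \<sigma>) (2 * t) \<in> carrier_mat n n"
    using R psd_mat_rpow[OF M] by (auto intro: psd_mat_carrier)
  then show ?thesis
    by (simp add: F_spec_def inv_geom_mean_unitary_conj[OF R S U] mat_rpow_unitary_conj[OF M U]
        unitary_conj_mult[OF U] mat_trace_unitary_conj[OF U])
qed

section \<open>Kronecker products\<close>

text \<open>The index encoding of \<open>kron\<close> turns a sum over pairs into one over a single range; this
  separates such a sum again.\<close>

lemma sum_div_mod:
  fixes f g :: "nat \<Rightarrow> 'a::comm_semiring_0"
  shows "(\<Sum>k<n * m. f (k div m) * g (k mod m)) = (\<Sum>i<n. f i) * (\<Sum>j<m. g j)"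
proof -
  have block: "(\<Sum>k = i * m..<i * m + m. f (k div m) * g (k mod m)) = (\<Sum>j<m. f i * g j)" for i
    unfolding sum.atLeastLessThan_shift_0[of _ "i * m"]
    by (simp add: atLeast0LessThan)
  have "(\<Sum>k<n * m. f (k div m) * g (k mod m))
      = (\<Sum>i<n. \<Sum>k = i * m..<i * m + m. f (k div m) * g (k mod m))"
    by (rule sum.nat_group[symmetric])
  then show ?thesis by (simp only: block sum_product)
qed

lemma kron_carrier [simp, intro]:
  "A \<in> carrier_mat n k \<Longrightarrow> B \<in> carrier_mat m l \<Longrightarrow> kron A B \<in> carrier_mat (n * m) (k * l)"
  by (auto simp: kron_def)

lemma kron_dim [simp]:
  "dim_row (kron A B) = dim_row A * dim_row B" "dim_col (kron A B) = dim_col A * dim_col B"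
  by (simp_all add: kron_def)

lemma div_mod_bounds:
  fixes i n m :: nat
  assumes "i < n * m"
  shows "i div m < n" "i mod m < m"
  using assms by (auto simp: less_mult_imp_div_less intro!: mod_less_divisor gr0I)

lemma kron_index:
  assumes "i < dim_row A * dim_row B" "j < dim_col A * dim_col B"
  shows "kron A B $$ (i, j)
       = A $$ (i div dim_row B, j div dim_col B) * B $$ (i mod dim_row B, j mod dim_col B)"
  using assms by (simp add: kron_def)

lemma kron_mult:
  assumes "A \<in> carrier_mat n k" "B \<in> carrier_mat m l" "C \<in> carrier_mat k p" "D \<in> carrier_mat l q"
  shows "kron A B * kron C D = kron (A * C) (B * D)"
proof (rule eq_matI)
  fix i j assume "i < dim_row (kron (A * C) (B * D))" "j < dim_col (kron (A * C) (B * D))"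
  then have ij: "i < n * m" "j < p * q" using assms by auto
  note b = div_mod_bounds[OF ij(1)] div_mod_bounds[OF ij(2)]
  have "(kron A B * kron C D) $$ (i, j) = (\<Sum>r<k * l. kron A B $$ (i, r) * kron C D $$ (r, j))"
    using ij assms by (auto simp: scalar_prod_def atLeast0LessThan)
  also have "\<dots> = (\<Sum>r<k * l. (A $$ (i div m, r div l) * C $$ (r div l, j div q)) *
                              (B $$ (i mod m, r mod l) * D $$ (r mod l, j mod q)))"
    using ij assms by (intro sum.cong) (auto simp: kron_index mult_ac)
  also have "\<dots> = (\<Sum>r<k. A $$ (i div m, r) * C $$ (r, j div q)) *
                  (\<Sum>r<l. B $$ (i mod m, r) * D $$ (r, j mod q))"
    by (rule sum_div_mod)
  also have "\<dots> = kron (A * C) (B * D) $$ (i, j)"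
    using ij b assms by (auto simp: kron_index scalar_prod_def atLeast0LessThan)
  finally show "(kron A B * kron C D) $$ (i, j) = kron (A * C) (B * D) $$ (i, j)" .
qed (use assms in auto)

lemma kron_adjoint: "mat_adjoint (kron A B) = kron (mat_adjoint A) (mat_adjoint B)"
  by (rule eq_matI) (auto simp: kron_index div_mod_bounds)

lemma kron_real_diag:
  "kron (real_diag n d) (real_diag m e) = real_diag (n * m) (\<lambda>i. d (i div m) * e (i mod m))"
proof (rule eq_matI)
  fix i j assume "i < dim_row (real_diag (n * m) (\<lambda>i. d (i div m) * e (i mod m)))"
    and "j < dim_col (real_diag (n * m) (\<lambda>i. d (i div m) * e (i mod m)))"
  then have ij: "i < n * m" "j < n * m" by (auto simp: mat_diag_def)
  have "i = j \<longleftrightarrow> i div m = j div m \<and> i mod m = j mod m"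
    by (metis div_mult_mod_eq)
  then show "kron (real_diag n d) (real_diag m e) $$ (i, j)
      = real_diag (n * m) (\<lambda>i. d (i div m) * e (i mod m)) $$ (i, j)"
    using ij div_mod_bounds[OF ij(1)] div_mod_bounds[OF ij(2)]
    by (auto simp: kron_index mat_diag_def)
qed (auto simp: mat_diag_def)

lemma kron_one: "kron (1\<^sub>m n) (1\<^sub>m m) = 1\<^sub>m (n * m)"
  using kron_real_diag[of n "\<lambda>_. 1" m "\<lambda>_. 1"] by simp

lemma mat_trace_kron:
  assumes "A \<in> carrier_mat n n" "B \<in> carrier_mat m m"
  shows "mat_trace (kron A B) = mat_trace A * mat_trace B"
proof -
  have "mat_trace (kron A B) = (\<Sum>i<n * m. A $$ (i div m, i div m) * B $$ (i mod m, i mod m))"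
    using assms by (auto simp: mat_trace_def kron_index)
  also have "\<dots> = mat_trace A * mat_trace B"
    using assms sum_div_mod[where f = "\<lambda>i. A $$ (i, i)" and g = "\<lambda>i. B $$ (i, i)"]
    by (simp add: mat_trace_def)
  finally show ?thesis .
qed

lemma unitary_mat_kron:
  assumes U: "unitary_mat n U" and V: "unitary_mat m V"
  shows "unitary_mat (n * m) (kron U V)"
proof (rule unitary_matI)
  have c: "U \<in> carrier_mat n n" "V \<in> carrier_mat m m"
    using U V by (auto intro: unitary_mat_carrier)
  then show "kron U V \<in> carrier_mat (n * m) (n * m)" by simp
  show "mat_adjoint (kron U V) * kron U V = 1\<^sub>m (n * m)"
    using U V c
    by (simp add: kron_adjoint kron_mult[of _ n n _ m m _ n _ m] unitary_mat_def kron_one)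
qed

lemma kron_unitary_conj:
  assumes "U \<in> carrier_mat n n" "A \<in> carrier_mat n n" "V \<in> carrier_mat m m" "B \<in> carrier_mat m m"
  shows "kron (U * A * mat_adjoint U) (V * B * mat_adjoint V)
       = kron U V * kron A B * mat_adjoint (kron U V)"
  using assms by (simp add: kron_adjoint kron_mult[of _ n n _ m m _ n _ m])

section \<open>Multiplicativity under tensor products\<close>

text \<open>Positivity of both factors matters: with \<open>powr\<close>, the rule \<open>(x y)\<^sup>s = x\<^sup>s y\<^sup>s\<close> is used for the
  eigenvalues, and it needs \<open>x\<close> and \<open>y\<close> nonnegative.\<close>

lemma mat_rpow_kron:
  assumes A: "psd_mat n A" and B: "psd_mat m B"
  shows "mat_rpow (kron A B) s = kron (mat_rpow A s) (mat_rpow B s)"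
proof -
  obtain U d where U: "unitary_mat n U" and d: "\<And>i. i < n \<Longrightarrow> 0 \<le> d i"
    and Ud: "A = U * real_diag n d * mat_adjoint U"
    using psd_diagonalization[OF A] by blast
  obtain V e where V: "unitary_mat m V" and e: "\<And>i. i < m \<Longrightarrow> 0 \<le> e i"
    and Ve: "B = V * real_diag m e * mat_adjoint V"
    using psd_diagonalization[OF B] by blast
  let ?W = "kron U V"
  have conj: "kron (U * real_diag n f * mat_adjoint U) (V * real_diag m g * mat_adjoint V)
      = ?W * real_diag (n * m) (\<lambda>i. f (i div m) * g (i mod m)) * mat_adjoint ?W" for f g
    by (simp only: kron_unitary_conj[OF unitary_mat_carrier[OF U] mat_diag_dim
          unitary_mat_carrier[OF V] mat_diag_dim] kron_real_diag)
  have "mat_rpow (kron A B) s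
      = ?W * real_diag (n * m) (\<lambda>i. supp_powr s (d (i div m) * e (i mod m))) * mat_adjoint ?W"
    by (rule mat_rpow_diag[OF unitary_mat_kron[OF U V]]) (simp only: Ud Ve conj)
  also have "real_diag (n * m) (\<lambda>i. supp_powr s (d (i div m) * e (i mod m)))
      = real_diag (n * m) (\<lambda>i. supp_powr s (d (i div m)) * supp_powr s (e (i mod m)))"
    by (rule mat_diag_cong) (simp add: supp_powr_mult d e div_mod_bounds)
  also have "?W * \<dots> * mat_adjoint ?W = kron (mat_rpow A s) (mat_rpow B s)"
    by (simp only: conj mat_rpow_diag[OF U Ud] mat_rpow_diag[OF V Ve])
  finally show ?thesis .
qed

lemma inv_geom_mean_kron:
  assumes R: "psd_mat n \<rho>" and S: "psd_mat n \<sigma>" and R': "psd_mat m \<rho>'" and S': "psd_mat m \<sigma>'"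
  shows "inv_geom_mean (kron \<rho> \<rho>') (kron \<sigma> \<sigma>') = kron (inv_geom_mean \<rho> \<sigma>) (inv_geom_mean \<rho>' \<sigma>')"
proof -
  note I = psd_inner_geom_mean[OF R S] and I' = psd_inner_geom_mean[OF R' S']
  note c = psd_mat_carrier[OF S] psd_mat_carrier[OF S']
    psd_mat_carrier[OF psd_mat_rpow[OF R]] psd_mat_carrier[OF psd_mat_rpow[OF R']]
    psd_mat_carrier[OF psd_mat_rpow[OF I]] psd_mat_carrier[OF psd_mat_rpow[OF I']]
  show ?thesis
    unfolding inv_geom_mean_def mat_rpow_kron[OF R R']
    by (simp add: c kron_mult[of _ n n _ m m _ n _ m] mat_rpow_kron[OF I I'])
qed

theorem F_spec_kron:
  assumes R: "psd_mat n \<rho>" and S: "psd_mat n \<sigma>" and R': "psd_mat m \<rho>'" and S': "psd_mat m \<sigma>'"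
  shows "F_spec t (kron \<rho> \<rho>') (kron \<sigma> \<sigma>') = F_spec t \<rho> \<sigma> * F_spec t \<rho>' \<sigma>'"
proof -
  note M = psd_inv_geom_mean[OF R S] and M' = psd_inv_geom_mean[OF R' S']
  note c = psd_mat_carrier[OF R] psd_mat_carrier[OF R']
    psd_mat_carrier[OF psd_mat_rpow[OF M]] psd_mat_carrier[OF psd_mat_rpow[OF M']]
  show ?thesis
    by (simp add: F_spec_def inv_geom_mean_kron[OF R S R' S'] mat_rpow_kron[OF M M'] c
        kron_mult[of _ n n _ m m _ n _ m] mat_trace_kron[of _ n _ m])
qed

text \<open>On an eigenvalue \<open>x > 0\<close> of \<open>\<tau>\<close> the mean takes the value \<open>x\<^sup>-\<^sup>1\<^sup>/\<^sup>2 x x\<^sup>-\<^sup>1\<^sup>/\<^sup>2 = 1\<close>, and on the kernel it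
  vanishes. Multiplying by \<open>\<tau>\<close> hides what a power of the mean does on the kernel, in
  particular the jump from the support projection to the identity at \<open>t = 0\<close>.\<close>

theorem F_spec_self:
  assumes T: "psd_mat n \<tau>"
  shows "F_spec t \<tau> \<tau> = mat_trace \<tau>"
proof -
  obtain U d where U: "unitary_mat n U" and d: "\<And>i. i < n \<Longrightarrow> 0 \<le> d i"
    and Ud: "\<tau> = U * real_diag n d * mat_adjoint U"
    using psd_diagonalization[OF T] by blast
  have mult: "(U * real_diag n f * mat_adjoint U) * (U * real_diag n g * mat_adjoint U)
      = U * real_diag n (\<lambda>i. f i * g i) * mat_adjoint U" for f g
    by (simp add: unitary_conj_mult[OF U])
  have "supp_powr (- 1/2) x * supp_powr (1/2) (supp_powr (1/2) x * x * supp_powr (1/2) x)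
      * supp_powr (- 1/2) x = (if x = 0 then 0 else 1)" if "0 \<le> x" for x
  proof -
    have "supp_powr (1/2) (supp_powr (1/2) x * x * supp_powr (1/2) x) = x"
      using that by (simp add: supp_powr_def powr_half_sqrt mult_ac)
    then show ?thesis
      using that by (simp add: supp_powr_def powr_minus powr_half_sqrt divide_simps)
  qed
  then have "real_diag n (\<lambda>i. supp_powr (- 1/2) (d i) * supp_powr (1/2) (supp_powr (1/2) (d i) * d i
      * supp_powr (1/2) (d i)) * supp_powr (- 1/2) (d i)) = real_diag n (\<lambda>i. if d i = 0 then 0 else 1)"
    using d by (intro mat_diag_cong) simp
  then have "inv_geom_mean \<tau> \<tau> = U * real_diag n (\<lambda>i. if d i = 0 then 0 else 1) * mat_adjoint U"
    unfolding inv_geom_mean_def Ud mat_rpow_diag[OF U refl] mult by simp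
  then have "\<tau> * mat_rpow (inv_geom_mean \<tau> \<tau>) (2 * t)
      = U * real_diag n (\<lambda>i. d i * supp_powr (2 * t) (if d i = 0 then 0 else 1)) * mat_adjoint U"
    by (simp only: mat_rpow_diag[OF U refl] mult Ud)
  also have "(\<lambda>i. d i * supp_powr (2 * t) (if d i = 0 then 0 else 1)) = d"
    by (auto simp: supp_powr_def)
  finally show ?thesis by (simp add: F_spec_def Ud)
qed

theorem proposition3p5:
  fixes t :: real and n m :: nat and \<rho> \<sigma> U \<tau> :: "complex mat"
  assumes "0 \<le> t" and "t \<le> 1"
    and "density_mat n \<rho>" and "density_mat n \<sigma>"
    and "unitary_mat n U"
    and "density_mat m \<tau>"
  shows "F_spec t (U * \<rho> * mat_adjoint U) (U * \<sigma> * mat_adjoint U) = F_spec t \<rho> \<sigma> \<and>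
         F_spec t (kron \<rho> \<tau>) (kron \<sigma> \<tau>) = F_spec t \<rho> \<sigma>"
proof -
  have "psd_mat n \<rho>" "psd_mat n \<sigma>" "psd_mat m \<tau>" and "mat_trace \<tau> = 1"
    using assms by (auto simp: density_mat_def)
  then show ?thesis
    using \<open>unitary_mat n U\<close> by (simp add: F_spec_unitary_conj F_spec_kron F_spec_self)
qed

end
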